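(* Let $\mathcal H$ be a real or complex Hilbert space and let $U_1,U_2$ be closed vector subspaces of $\mathcal H$ with orthogonal projectors $P_1,P_2$. Suppose that $U_1\cap U_2=\{0\}$, that $(U_1,U_2)$ does not satisfy the inverse best approximation property, and that $(u_1,u_2)\in U_1\times U_2$ is such that $S(u_1,u_2)=\{x\in\mathcal H : P_1x=u_1,\ P_2x=u_2\}\neq\varnothing$. Let $(\alpha_n)_{n\in\mathbb N}$ be a sequence in $]0,1[$ such that $\alpha_n\downarrow0$. Then there exists $r\in\mathcal H$ such that the sequence $(x_n)_{n\in\mathbb N}$ defined by $$x_0=r\quad\text{and}\quad(\forall n\in\mathbb N)\quad x_{n+1}=Q_1Q_2x_n$$ satisfies $$(\forall n\in\mathbb N)\quad\|x_n-B(r;u_1,u_2)\|\ge\alpha_n.$$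
   Context: $(U_1,U_2)$ satisfies the inverse best approximation property (IBAP) if for every $(v_1,v_2)\in U_1\times U_2$ there exists $x\in\mathcal H$ such that $P_1x=v_1$ and $P_2x=v_2$. For $i\in\{1,2\}$, $Q_i$ is the projector onto the closed affine subspace $u_i+U_i^\bot$, i.e. $Q_ix=u_i+x-P_ix$. $B(r;u_1,u_2)$ is the best approximation to (projection of) $r$ from the closed affine subspace $S(u_1,u_2)=(u_1+U_1^\bot)\cap(u_2+U_2^\bot)$. The notation $\alpha_n\downarrow0$ means that $(\alpha_n)$ decreases to $0$. *)

theory Defs
  imports "HOL-Analysis.Analysis"
begin

section \<open>Complex inner product spaces\<close>

text \<open>
  The library has only real inner product spaces. A complex inner product space is, by
  restriction of scalars, also a real one whose inner product is the real part of the complex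
  one and which has the same norm; the class records both structures. Positive definiteness is
  therefore inherited from \<^class>\<open>real_inner\<close>, see \<open>cinner_self\<close> and
  \<open>norm_eq_sqrt_cinner\<close> below. The product is linear in its first argument.
\<close>

class complex_inner = real_inner +
  fixes scaleC :: "complex \<Rightarrow> 'a \<Rightarrow> 'a" (infixr \<open>*\<^sub>C\<close> 75)
    and cinner :: "'a \<Rightarrow> 'a \<Rightarrow> complex"
  assumes scaleC_add_right: "a *\<^sub>C (x + y) = a *\<^sub>C x + a *\<^sub>C y"
    and scaleC_add_left: "(a + b) *\<^sub>C x = a *\<^sub>C x + b *\<^sub>C x"
    and scaleC_scaleC: "a *\<^sub>C (b *\<^sub>C x) = (a * b) *\<^sub>C x"
    and scaleR_eq_scaleC: "scaleR r x = of_real r *\<^sub>C x"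
    and cinner_commute: "cinner x y = cnj (cinner y x)"
    and cinner_add_left: "cinner (x + y) z = cinner x z + cinner y z"
    and cinner_scaleC_left: "cinner (a *\<^sub>C x) y = a * cinner x y"
    and inner_eq_Re_cinner: "inner x y = Re (cinner x y)"

interpretation complex_inner: vector_space "scaleC :: complex \<Rightarrow> 'a::complex_inner \<Rightarrow> 'a"
proof
  fix x :: 'a
  show "1 *\<^sub>C x = x" using scaleR_eq_scaleC[of 1 x] by simp
qed (auto simp: scaleC_add_right scaleC_add_left scaleC_scaleC)

lemma cinner_self: "cinner x x = of_real (inner x x)"
proof -
  have "Im (cinner x x) = 0" using arg_cong[OF cinner_commute[of x x], of Im] by simp
  then show ?thesis by (simp add: complex_eq_iff inner_eq_Re_cinner)
qed

lemma norm_eq_sqrt_cinner: "norm x = sqrt (cmod (cinner x x))"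
  by (simp add: cinner_self norm_of_real norm_eq_sqrt_inner[of x])

instantiation complex :: complex_inner
begin

definition scaleC_complex :: "complex \<Rightarrow> complex \<Rightarrow> complex"
  where "scaleC_complex a x = a * x"

definition cinner_complex :: "complex \<Rightarrow> complex \<Rightarrow> complex"
  where "cinner_complex x y = x * cnj y"

instance
  by standard
    (auto simp: scaleC_complex_def cinner_complex_def algebra_simps scaleR_conv_of_real inner_complex_def)

end

abbreviation csubspace :: "'a::complex_inner set \<Rightarrow> bool"
  where "csubspace \<equiv> module.subspace scaleC"

definition corthogonal_comp :: "'a::complex_inner set \<Rightarrow> 'a set"
  where "corthogonal_comp U = {x. \<forall>y\<in>U. cinner y x = 0}"

lemma csubspace_imp_subspace: "csubspace U \<Longrightarrow> subspace U"
  by (auto simp: complex_inner.subspace_def subspace_def scaleR_eq_scaleC)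

lemma corthogonal_comp_eq:
  assumes "csubspace U"
  shows "corthogonal_comp U = orthogonal_comp U"
proof (intro equalityI subsetI)
  fix x assume "x \<in> corthogonal_comp U"
  then show "x \<in> orthogonal_comp U"
    by (simp add: corthogonal_comp_def orthogonal_comp_def orthogonal_def inner_eq_Re_cinner)
next
  fix x assume x: "x \<in> orthogonal_comp U"
  have "cinner y x = 0" if y: "y \<in> U" for y
  proof -
    have iy: "\<i> *\<^sub>C y \<in> U" using assms y by (simp add: complex_inner.subspace_scale)
    from x y have "Re (cinner y x) = 0"
      by (auto simp: orthogonal_comp_def orthogonal_def inner_eq_Re_cinner)
    moreover from x iy have "Re (cinner (\<i> *\<^sub>C y) x) = 0"
      by (auto simp: orthogonal_comp_def orthogonal_def inner_eq_Re_cinner)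
    ultimately show ?thesis by (simp add: cinner_scaleC_left complex_eq_iff)
  qed
  then show "x \<in> corthogonal_comp U" by (simp add: corthogonal_comp_def)
qed


section \<open>Projectors\<close>

text \<open>
  The library's \<^const>\<open>closest_point\<close>, freed from its finite-dimensional class constraint. It is
  well defined on nonempty closed convex subsets of a Hilbert space.
\<close>

definition projector :: "'a::real_inner set \<Rightarrow> 'a \<Rightarrow> 'a"
  where "projector C x = (SOME p. p \<in> C \<and> (\<forall>y\<in>C. dist x p \<le> dist x y))"

lemma nearest_point_exists:
  fixes C :: "'a::{real_inner,complete_space} set"
  assumes "closed C" "convex C" "C \<noteq> {}"
  shows "\<exists>p\<in>C. \<forall>y\<in>C. dist x p \<le> dist x y"
proof -
  define d where "d = infdist x C"
  have d0: "d \<ge> 0" by (simp add: d_def infdist_nonneg)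
  have dle: "d \<le> dist x y" if "y \<in> C" for y using that by (simp add: d_def infdist_le)
  define D where "D n = C \<inter> cball x (d + 1 / real (Suc n))" for n
  have cl: "closed (D n)" for n using assms by (auto simp: D_def)
  have ne: "D n \<noteq> {}" for n
  proof -
    have "infdist x C < d + 1 / real (Suc n)" by (simp add: d_def)
    then obtain y where "y \<in> C" "dist x y < d + 1 / real (Suc n)"
      using assms(3) by (auto simp: infdist_def cINF_less_iff)
    then show ?thesis by (force simp: D_def)
  qed
  have dec: "D n \<subseteq> D m" if "m \<le> n" for m n
  proof -
    have "1 / real (Suc n) \<le> 1 / real (Suc m)" using that by (simp add: frac_le)
    then show ?thesis by (auto simp: D_def)
  qed
  have small: "\<exists>n. \<forall>y\<in>D n. \<forall>z\<in>D n. dist y z < e" if "e > 0" for e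
  proof -
    have lim: "(\<lambda>n. 4 * (d + 1 / real (Suc n))\<^sup>2 - 4 * d\<^sup>2) \<longlonglongrightarrow> 4 * (d + 0)\<^sup>2 - 4 * d\<^sup>2"
      by (intro tendsto_intros LIMSEQ_Suc[OF lim_1_over_n])
    have "\<forall>\<^sub>F n in sequentially. 4 * (d + 1 / real (Suc n))\<^sup>2 - 4 * d\<^sup>2 < e\<^sup>2"
      using order_tendstoD(2)[OF lim, of "e\<^sup>2"] that by simp
    then obtain n where n: "4 * (d + 1 / real (Suc n))\<^sup>2 - 4 * d\<^sup>2 < e\<^sup>2"
      by (auto simp: eventually_sequentially)
    have "dist y z < e" if yz: "y \<in> D n" "z \<in> D n" for y z
    proof -
      define m where "m = (1/2) *\<^sub>R y + (1/2) *\<^sub>R z"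
      have "m \<in> C" using yz assms(2) unfolding m_def D_def by (intro convexD) auto
      then have "d\<^sup>2 \<le> (norm (x - m))\<^sup>2"
        using dle[of m] d0 by (simp add: dist_norm power_mono)
      moreover have "(norm (x - y))\<^sup>2 \<le> (d + 1 / real (Suc n))\<^sup>2"
        "(norm (x - z))\<^sup>2 \<le> (d + 1 / real (Suc n))\<^sup>2"
        using yz by (auto simp: D_def dist_norm intro!: power_mono)
      moreover have "(norm (y - z))\<^sup>2 + 4 * (norm (x - m))\<^sup>2
          = 2 * (norm (x - y))\<^sup>2 + 2 * (norm (x - z))\<^sup>2"
        by (simp add: m_def power2_norm_eq_inner inner_simps inner_commute)
      ultimately have "(norm (y - z))\<^sup>2 < e\<^sup>2" using n by linarith
      then show ?thesis using \<open>e > 0\<close> by (simp add: dist_norm power2_less_imp_less)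
    qed
    then show ?thesis by blast
  qed
  obtain p where p: "\<And>n. p \<in> D n" using decreasing_closed_nest[of D] cl ne dec small by blast
  have "dist x p \<le> d"
  proof (rule LIMSEQ_le_const)
    have "(\<lambda>n. d + 1 / real (Suc n)) \<longlonglongrightarrow> d + 0"
      by (intro tendsto_intros LIMSEQ_Suc[OF lim_1_over_n])
    then show "(\<lambda>n. d + 1 / real (Suc n)) \<longlonglongrightarrow> d" by simp
    show "\<exists>N. \<forall>n\<ge>N. dist x p \<le> d + 1 / real (Suc n)" using p by (auto simp: D_def)
  qed
  moreover have "p \<in> C" using p[of 0] by (simp add: D_def)
  ultimately show ?thesis using dle by (meson order_trans)
qed

lemma projector_eqI:
  assumes p: "p \<in> C" and var: "\<And>y. y \<in> C \<Longrightarrow> inner (x - p) (y - p) \<le> 0"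
  shows "projector C x = p"
proof -
  have sq: "(norm (x - p))\<^sup>2 + (norm (p - y))\<^sup>2 \<le> (norm (x - y))\<^sup>2" if "y \<in> C" for y
  proof -
    have "(norm (x - y))\<^sup>2 = (norm (x - p))\<^sup>2 + (norm (p - y))\<^sup>2 - 2 * inner (x - p) (y - p)"
      by (simp add: power2_norm_eq_inner inner_simps inner_commute)
    then show ?thesis using var[OF that] by simp
  qed
  let ?P = "\<lambda>q. q \<in> C \<and> (\<forall>y\<in>C. dist x q \<le> dist x y)"
  have "(norm (x - p))\<^sup>2 \<le> (norm (x - y))\<^sup>2" if "y \<in> C" for y
    using sq[OF that] zero_le_power2[of "norm (p - y)"] by linarith
  then have "?P p" using p by (simp add: dist_norm)
  then have "?P (projector C x)" unfolding projector_def by (rule someI)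
  then have "(norm (x - projector C x))\<^sup>2 \<le> (norm (x - p))\<^sup>2" "projector C x \<in> C"
    using p by (auto simp: dist_norm intro!: power_mono)
  then have "(norm (p - projector C x))\<^sup>2 \<le> 0"
    using sq[of "projector C x"] by linarith
  then show ?thesis by simp
qed

text \<open>On a closed subspace, \<^const>\<open>projector\<close> is the orthogonal projector.\<close>

lemma projector_subspace:
  fixes U :: "'a::{real_inner,complete_space} set"
  assumes "closed U" "subspace U"
  shows "projector U x \<in> U" "x - projector U x \<in> orthogonal_comp U"
proof -
  have "\<exists>p. p \<in> U \<and> (\<forall>y\<in>U. dist x p \<le> dist x y)"
    using nearest_point_exists[of U x] assms subspace_imp_convex subspace_0 by blast
  then have P: "projector U x \<in> U \<and> (\<forall>y\<in>U. dist x (projector U x) \<le> dist x y)"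
    unfolding projector_def by (rule someI_ex)
  then show p: "projector U x \<in> U" by blast
  define w where "w = x - projector U x"
  have "inner y w = 0" if y: "y \<in> U" for y
  proof (cases "y = 0")
    case False
    define t where "t = inner y w / inner y y"
    have "projector U x + t *\<^sub>R y \<in> U" using assms(2) p y by (simp add: subspace_add subspace_scale)
    then have "norm w \<le> norm (w - t *\<^sub>R y)"
      using P by (auto simp: dist_norm w_def algebra_simps)
    then have "(norm w)\<^sup>2 \<le> (norm (w - t *\<^sub>R y))\<^sup>2" by (simp add: power_mono)
    also have "\<dots> = (norm w)\<^sup>2 - 2 * t * inner y w + t\<^sup>2 * inner y y"
      by (simp add: power2_norm_eq_inner inner_simps inner_commute[of w y])
        (simp add: power2_eq_square algebra_simps)
    also have "\<dots> = (norm w)\<^sup>2 - (inner y w)\<^sup>2 / inner y y"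
      using False by (simp add: t_def power2_eq_square field_simps)
    finally have "(inner y w)\<^sup>2 / inner y y \<le> 0" by simp
    moreover have "inner y y > 0" using False by simp
    ultimately show ?thesis by (simp add: divide_le_0_iff)
  qed simp
  then show "x - projector U x \<in> orthogonal_comp U"
    by (simp add: orthogonal_comp_def orthogonal_def w_def)
qed

lemma projector_affine:
  fixes U :: "'a::{real_inner,complete_space} set"
  assumes "closed U" "subspace U" "u \<in> U"
  shows "projector ((+) u ` orthogonal_comp U) x = u + x - projector U x"
proof (rule projector_eqI)
  note P = projector_subspace[OF assms(1,2), of x]
  show "u + x - projector U x \<in> (+) u ` orthogonal_comp U"
    using P(2) by (force simp: algebra_simps)
  fix y assume "y \<in> (+) u ` orthogonal_comp U"
  then obtain v where v: "v \<in> orthogonal_comp U" "y = u + v" by blast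
  have "projector U x - u \<in> U" using P(1) assms by (simp add: subspace_diff)
  moreover have "v - (x - projector U x) \<in> orthogonal_comp U"
    using v P(2) subspace_orthogonal_comp subspace_diff by blast
  ultimately have "inner (projector U x - u) (v - (x - projector U x)) = 0"
    by (auto simp: orthogonal_comp_def orthogonal_def)
  then show "inner (x - (u + x - projector U x)) (y - (u + x - projector U x)) \<le> 0"
    by (simp add: v algebra_simps)
qed

definition ibap :: "'a::real_inner set \<Rightarrow> 'a set \<Rightarrow> bool"
  where "ibap U1 U2 \<longleftrightarrow>
    (\<forall>v1\<in>U1. \<forall>v2\<in>U2. \<exists>x. projector U1 x = v1 \<and> projector U2 x = v2)"

definition interp_set :: "'a::real_inner set \<Rightarrow> 'a set \<Rightarrow> 'a \<Rightarrow> 'a \<Rightarrow> 'a set"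
  where "interp_set U1 U2 u1 u2 = {x. projector U1 x = u1 \<and> projector U2 x = u2}"

text \<open>The description of the solution set as an intersection of affine subspaces.\<close>

lemma interp_set_eq:
  fixes U1 U2 :: "'a::{real_inner,complete_space} set"
  assumes "closed U1" "subspace U1" "closed U2" "subspace U2" "u1 \<in> U1" "u2 \<in> U2"
  shows "interp_set U1 U2 u1 u2 = ((+) u1 ` orthogonal_comp U1) \<inter> ((+) u2 ` orthogonal_comp U2)"
proof -
  have "projector U x = u \<longleftrightarrow> x \<in> (+) u ` orthogonal_comp U"
    if U: "closed U" "subspace U" "u \<in> U" for U u and x :: 'a
  proof
    assume "projector U x = u"
    then show "x \<in> (+) u ` orthogonal_comp U"
      using projector_subspace(2)[OF U(1,2), of x] by (force simp: algebra_simps)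
  next
    assume "x \<in> (+) u ` orthogonal_comp U"
    then obtain v where v: "v \<in> orthogonal_comp U" "x = u + v" by blast
    show "projector U x = u"
    proof (rule projector_eqI)
      fix y assume "y \<in> U"
      then have "y - u \<in> U" using U by (simp add: subspace_diff)
      then show "inner (x - u) (y - u) \<le> 0"
        using v by (simp add: orthogonal_comp_def orthogonal_def inner_commute[of v])
    qed (use U in simp)
  qed
  then show ?thesis using assms by (auto simp: interp_set_def)
qed

end

theory Submission
  imports Defs
begin

text \<open>
  Let \<open>s\<close> be a point of the solution set, \<open>M\<close> and \<open>N\<close> the orthogonal complements of the two
  subspaces, and \<open>T = P\<^sub>M P\<^sub>N\<close>. Moving the origin to \<open>s\<close> turns the iteration into
  \<open>x\<^sub>n = s + T\<^sup>n y\<close> with \<open>y = r - s\<close>, and if \<open>y\<close> is orthogonal to \<open>M \<inter> N\<close> then \<open>s\<close> is also the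
  best approximation to \<open>r\<close>. So the task is to find \<open>y \<in> K = (M \<inter> N)\<^sup>\<bottom>\<close> whose orbit under \<open>T\<close>
  satisfies \<open>\<alpha> n \<le> \<parallel>T\<^sup>n y\<parallel>\<close> for all \<open>n\<close>.

  Failure of the inverse best approximation property makes \<open>T\<close> almost fix some unit vectors of
  \<open>K\<close>. Otherwise the form \<open>\<parallel>P\<^sub>1 z\<parallel>\<^sup>2 + \<parallel>P\<^sub>2 z\<parallel>\<^sup>2\<close> would be coercive on \<open>K\<close>, so that \<open>P\<^sub>1 + P\<^sub>2\<close> would
  map \<open>K\<close> onto itself; but a solution of \<open>P\<^sub>1 z + P\<^sub>2 z = a + b\<close> with \<open>a\<close> in the first and
  \<open>b\<close> in the second subspace solves \<open>P\<^sub>1 z = a\<close>, \<open>P\<^sub>2 z = b\<close>, because the subspaces meet only in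
  \<open>0\<close> (lemma \<open>coercive_imp_ibap\<close>). Hence every power of \<open>T\<close> leaves some unit vector of \<open>K\<close> with norm
  at least \<open>3 / 4\<close> (lemma \<open>not_ibap_imp_powers_almost_isometric\<close>).

  For any linear map with this last property that never increases the norm, slow orbits exist by
  a gliding hump (lemma \<open>slow_orbit_exists\<close>): perturbations of geometrically decreasing size make
  the orbit large at ever later times, and the later ones together cannot undo an earlier one.
  The rate at which \<open>\<alpha>\<close> tends to \<open>0\<close> only decides how late those times have to be.

  A complex Hilbert space is also a real one with the same orthogonal complements of complex
  subspaces, so the complex case is an instance of the real one.
\<close>


section \<open>Slow orbits of nonexpansive linear maps\<close>

lemma linear_funpow:
  fixes T :: "'a::real_vector \<Rightarrow> 'a"
  assumes "linear T"
  shows "linear (T ^^ n)"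
proof (induction n)
  case (Suc n)
  then show ?case using linear_compose[OF Suc assms] by (simp add: o_def)
qed (simp add: linear_id[unfolded id_def])

lemma norm_funpow_antimono:
  fixes T :: "'a::real_normed_vector \<Rightarrow> 'a"
  assumes "\<And>x. norm (T x) \<le> norm x" and "m \<le> n"
  shows "norm ((T ^^ n) x) \<le> norm ((T ^^ m) x)"
  using assms(2)
proof (induction n rule: dec_induct)
  case (step n)
  then show ?case using assms(1)[of "(T ^^ n) x"] by simp
qed simp

text \<open>
  Of the two points \<open>y + v\<close> and \<open>y - v\<close> one has an image at least as long as that of \<open>v\<close>, since
  \<open>v\<close> is half their difference. So one vector \<open>v\<close> serves for perturbing every \<open>y\<close>.
\<close>

lemma enlarge_image_by_perturbation:
  fixes L :: "'a::real_normed_vector \<Rightarrow> 'a"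
  assumes "linear L" "subspace K" "y \<in> K" "z \<in> K" "norm z = 1" "c \<ge> 0"
  shows "\<exists>w\<in>K. dist y w \<le> c \<and> c * norm (L z) \<le> norm (L w)"
proof -
  interpret linear L by fact
  define v where "v = c *\<^sub>R z"
  have v: "v \<in> K" "norm v = c" "norm (L v) = c * norm (L z)"
    using assms by (auto simp: v_def subspace_scale scale)
  have "2 * norm (L v) = norm (L (y + v) - L (y - v))"
    by (simp add: add diff flip: scaleR_2)
  also have "\<dots> \<le> norm (L (y + v)) + norm (L (y - v))" by (rule norm_triangle_ineq4)
  finally consider "norm (L v) \<le> norm (L (y + v))" | "norm (L v) \<le> norm (L (y - v))" by linarith
  then show ?thesis
  proof cases
    case 1
    then show ?thesis
      using v assms by (intro bexI[of _ "y + v"]) (auto simp: dist_norm subspace_add)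
  next
    case 2
    then show ?thesis
      using v assms by (intro bexI[of _ "y - v"]) (auto simp: dist_norm subspace_diff)
  qed
qed

text \<open>
  The radii \<open>4 / 3 ^ k\<close> decrease so fast that the perturbations after step \<open>k\<close> add up to at most
  half of the \<open>k\<close>-th one. As step \<open>k\<close> makes the image at time \<open>N k\<close> at least three quarters of its
  radius, a quarter of that radius, \<open>1 / 3 ^ k\<close>, is left in the limit. Norms along an orbit
  decrease, so this bounds the orbit at all times up to \<open>N k\<close>; the time \<open>N k\<close> is taken late enough
  that from there on \<open>\<alpha>\<close> is below the bound of the next step.
\<close>

lemma slow_orbit_exists:
  fixes T :: "'a::{real_normed_vector,complete_space} \<Rightarrow> 'a" and \<alpha> :: "nat \<Rightarrow> real"
  assumes "linear T" and contr: "\<And>x. norm (T x) \<le> norm x"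
    and "subspace K" "closed K"
    and unit: "\<And>n. \<exists>z\<in>K. norm z = 1 \<and> 3/4 \<le> norm ((T ^^ n) z)"
    and le1: "\<And>n. \<alpha> n \<le> 1" and lim: "\<alpha> \<longlonglongrightarrow> 0"
  shows "\<exists>y\<in>K. \<forall>n. \<alpha> n \<le> norm ((T ^^ n) y)"
proof -
  have "\<exists>N\<ge>k. \<forall>m\<ge>N. \<alpha> m \<le> 1 / 3 ^ Suc k" for k
  proof -
    have "\<forall>\<^sub>F m in sequentially. \<alpha> m < 1 / 3 ^ Suc k"
      using lim by (rule order_tendstoD) simp
    then obtain N where "\<And>m. m \<ge> N \<Longrightarrow> \<alpha> m < 1 / 3 ^ Suc k"
      by (auto simp: eventually_sequentially)
    then show ?thesis by (intro exI[of _ "max k N"]) (auto intro: less_imp_le)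
  qed
  then obtain N where N: "\<And>k. k \<le> N k" "\<And>k m. N k \<le> m \<Longrightarrow> \<alpha> m \<le> 1 / 3 ^ Suc k"
    by metis
  define c :: "nat \<Rightarrow> real" where "c k = 4 / 3 ^ k" for k
  have c0: "c k \<ge> 0" for k by (simp add: c_def)
  have perturb: "\<exists>w. (w \<in> K \<and> 3/4 * c k \<le> norm ((T ^^ N k) w)) \<and> dist y w \<le> c k"
    if y: "y \<in> K" for y k
  proof -
    obtain z where z: "z \<in> K" "norm z = 1" "3/4 \<le> norm ((T ^^ N k) z)" using unit by blast
    obtain w where w: "w \<in> K" "dist y w \<le> c k" "c k * norm ((T ^^ N k) z) \<le> norm ((T ^^ N k) w)"
      using enlarge_image_by_perturbation[OF linear_funpow[OF \<open>linear T\<close>] \<open>subspace K\<close> y z(1,2) c0]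
      by blast
    have "c k * (3/4) \<le> c k * norm ((T ^^ N k) z)" using z(3) c0 by (rule mult_left_mono)
    with w show ?thesis by auto
  qed
  have "\<exists>Y. \<forall>k. (Y k \<in> K \<and> 3/4 * c k \<le> norm ((T ^^ N k) (Y k))) \<and>
      dist (Y k) (Y (Suc k)) \<le> c (Suc k)"
  proof (rule dependent_nat_choice)
    show "\<exists>w. w \<in> K \<and> 3/4 * c 0 \<le> norm ((T ^^ N 0) w)"
      using perturb[OF subspace_0[OF \<open>subspace K\<close>], of 0] by blast
  qed (use perturb in blast)
  then obtain Y where Y: "\<And>k. Y k \<in> K" "\<And>k. 3/4 * c k \<le> norm ((T ^^ N k) (Y k))"
    "\<And>k. dist (Y k) (Y (Suc k)) \<le> c (Suc k)" by blast
  define B where "B k = K \<inter> cball (Y k) (c k / 2)" for k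
  have "\<exists>y. \<forall>k. y \<in> B k"
  proof (rule decreasing_closed_nest[of B])
    show "closed (B k)" for k using \<open>closed K\<close> by (auto simp: B_def)
    have "Y k \<in> B k" for k using Y(1) c0[of k] by (simp add: B_def)
    then show "B k \<noteq> {}" for k by blast
    have "B (Suc k) \<subseteq> B k" for k
    proof -
      have "dist (Y k) x \<le> c k / 2" if "dist (Y (Suc k)) x \<le> c (Suc k) / 2" for x
        using dist_triangle[of "Y k" x "Y (Suc k)"] Y(3)[of k] that by (simp add: c_def)
      then show ?thesis by (auto simp: B_def)
    qed
    then show "B n \<subseteq> B m" if "m \<le> n" for m n
      using that lift_Suc_antimono_le[of B] by blast
    show "\<exists>k. \<forall>x\<in>B k. \<forall>y\<in>B k. dist x y < e" if "e > 0" for e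
    proof -
      have "\<exists>k. (1/3) ^ k < e / 4" using that by (intro real_arch_pow_inv) auto
      then obtain k where "(1/3) ^ k < e / 4" by blast
      then have "c k < e" by (simp add: c_def power_divide)
      then have "dist x y < e" if "x \<in> B k" "y \<in> B k" for x y
        using that dist_triangle3[of x y "Y k"] by (auto simp: B_def)
      then show ?thesis by blast
    qed
  qed blast
  then obtain y where y: "\<And>k. y \<in> B k" by blast
  have bound: "1 / 3 ^ k \<le> norm ((T ^^ N k) y)" for k
  proof -
    interpret Tn: linear "T ^^ N k" using linear_funpow[OF \<open>linear T\<close>] .
    have "norm ((T ^^ N k) (Y k)) - norm ((T ^^ N k) y) \<le> norm ((T ^^ N k) (Y k - y))"
      by (simp add: Tn.diff norm_triangle_ineq2)
    also have "\<dots> \<le> norm (Y k - y)"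
      using norm_funpow_antimono[of T 0 "N k"] contr by simp
    also have "\<dots> \<le> c k / 2" using y[of k] by (simp add: B_def dist_norm)
    finally show ?thesis using Y(2)[of k] by (simp add: c_def)
  qed
  have "\<alpha> n \<le> norm ((T ^^ n) y)" for n
  proof -
    define k where "k = (LEAST k. n \<le> N k)"
    have "n \<le> N k" unfolding k_def using N(1) by (rule LeastI)
    have "\<alpha> n \<le> 1 / 3 ^ k"
    proof (cases k)
      case 0
      then show ?thesis using le1[of n] by simp
    next
      case (Suc j)
      then have "\<not> n \<le> N j" using not_less_Least[of j "\<lambda>k. n \<le> N k"] by (simp add: k_def)
      then show ?thesis using N(2)[of j n] Suc by simp
    qed
    also have "\<dots> \<le> norm ((T ^^ N k) y)" by (rule bound)
    also have "\<dots> \<le> norm ((T ^^ n) y)" using contr \<open>n \<le> N k\<close> by (rule norm_funpow_antimono)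
    finally show ?thesis .
  qed
  then show ?thesis using y[of 0] by (auto simp: B_def)
qed


section \<open>Orthogonal projectors\<close>

lemma closed_orthogonal_comp: "closed (orthogonal_comp W)"
proof -
  have "orthogonal_comp W = (\<Inter>y\<in>W. {x. inner y x = 0})"
    by (auto simp: orthogonal_comp_def orthogonal_def)
  then show ?thesis by (auto intro!: closed_INT closed_Collect_eq continuous_intros)
qed

lemma inner_orthogonal_comp: "y \<in> W \<Longrightarrow> x \<in> orthogonal_comp W \<Longrightarrow> inner y x = 0"
  by (simp add: orthogonal_comp_def orthogonal_def)

lemma projector_subspace_eqI:
  assumes "subspace U" "p \<in> U" "x - p \<in> orthogonal_comp U"
  shows "projector U x = p"
proof (rule projector_eqI)
  fix y assume "y \<in> U"
  then have "inner (y - p) (x - p) = 0"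
    using assms by (intro inner_orthogonal_comp) (auto simp: subspace_diff)
  then show "inner (x - p) (y - p) \<le> 0" by (simp add: inner_commute)
qed fact

context
  fixes U :: "'a::{real_inner,complete_space} set"
  assumes U: "closed U" "subspace U"
begin

lemma linear_projector: "linear (projector U)"
proof (rule linearI)
  note P = projector_subspace[OF U]
  fix x y :: 'a and a :: real
  have "x + y - (projector U x + projector U y) = (x - projector U x) + (y - projector U y)"
    by simp
  also have "\<dots> \<in> orthogonal_comp U" using P(2) by (intro subspace_add subspace_orthogonal_comp)
  finally show "projector U (x + y) = projector U x + projector U y"
    using P(1) U by (intro projector_subspace_eqI) (auto simp: subspace_add)
  have "a *\<^sub>R x - a *\<^sub>R projector U x = a *\<^sub>R (x - projector U x)"
    by (simp add: scaleR_diff_right)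
  also have "\<dots> \<in> orthogonal_comp U" using P(2) by (intro subspace_scale subspace_orthogonal_comp)
  finally show "projector U (a *\<^sub>R x) = a *\<^sub>R projector U x"
    using P(1) U by (intro projector_subspace_eqI) (auto simp: subspace_scale)
qed

lemma inner_projector_self: "inner (projector U x) x = (norm (projector U x))\<^sup>2"
  using inner_orthogonal_comp[OF projector_subspace[OF U, of x]]
  by (simp add: inner_diff_right power2_norm_eq_inner)

lemma norm_projector_complement:
  "(norm (x - projector U x))\<^sup>2 = (norm x)\<^sup>2 - (norm (projector U x))\<^sup>2"
  using inner_projector_self[of x]
  by (simp add: power2_norm_eq_inner inner_diff_left inner_diff_right inner_commute[of x "projector U x"])

lemma norm_projector_complement_le: "norm (x - projector U x) \<le> norm x"
  by (rule power2_le_imp_le) (simp_all add: norm_projector_complement)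

end


section \<open>Failure of the inverse best approximation property\<close>

definition alternating_step :: "'a::real_inner set \<Rightarrow> 'a set \<Rightarrow> 'a \<Rightarrow> 'a"
  where "alternating_step U1 U2 x =
    (let y = x - projector U2 x in y - projector U1 y)"

context
  fixes U1 U2 K :: "'a::{real_inner,complete_space} set"
  assumes U1: "closed U1" "subspace U1" and U2: "closed U2" "subspace U2"
    and K: "closed K" "subspace K" "U1 \<subseteq> K" "U2 \<subseteq> K"
begin

text \<open>
  Write \<open>S = P\<^sub>1 + P\<^sub>2\<close>. The form below is \<open>\<langle>S z, z\<rangle>\<close>, and \<open>\<parallel>S z\<parallel>\<^sup>2 \<le> 2 \<langle>S z, z\<rangle>\<close>. Hence
  \<open>\<parallel>z - S z / 2\<parallel>\<^sup>2 \<le> \<parallel>z\<parallel>\<^sup>2 - \<langle>S z, z\<rangle> / 2\<close>, and under coercivity the iteration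
  \<open>z \<mapsto> z - (S z - w) / 2\<close> is a strict contraction of \<open>K\<close>, whose fixed point solves \<open>S z = w\<close>.
\<close>

lemma coercive_imp_ibap:
  assumes int: "U1 \<inter> U2 = {0}" and "0 < d" "d \<le> 1"
    and coercive: "\<And>z. z \<in> K \<Longrightarrow>
      d * (norm z)\<^sup>2 \<le> (norm (projector U1 z))\<^sup>2 + (norm (projector U2 z))\<^sup>2"
  shows "ibap U1 U2"
  unfolding ibap_def
proof (intro ballI)
  fix a b assume ab: "a \<in> U1" "b \<in> U2"
  interpret P1: linear "projector U1" by (rule linear_projector[OF U1])
  interpret P2: linear "projector U2" by (rule linear_projector[OF U2])
  note in_U = projector_subspace(1)[OF U1] projector_subspace(1)[OF U2]
  define S where "S z = projector U1 z + projector U2 z" for z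
  have Sdiff: "S (x - y) = S x - S y" for x y by (simp add: S_def P1.diff P2.diff)
  define f where "f z = z - (1/2) *\<^sub>R (S z - (a + b))" for z
  have shrink: "(norm (z - (1/2) *\<^sub>R S z))\<^sup>2 \<le> (1 - d/2) * (norm z)\<^sup>2" if "z \<in> K" for z
  proof -
    define q where "q = (norm (projector U1 z))\<^sup>2 + (norm (projector U2 z))\<^sup>2"
    have "inner (S z) z = q"
      by (simp add: S_def q_def inner_add_left inner_projector_self U1 U2)
    moreover have "(norm (S z))\<^sup>2 + (norm (projector U1 z - projector U2 z))\<^sup>2 = 2 * q"
      by (simp add: S_def q_def power2_norm_eq_inner inner_simps inner_commute)
    then have "(norm (S z))\<^sup>2 \<le> 2 * q"
      using zero_le_power2[of "norm (projector U1 z - projector U2 z)"] by linarith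
    moreover have "(norm (z - (1/2) *\<^sub>R S z))\<^sup>2 = (norm z)\<^sup>2 - inner (S z) z + (norm (S z))\<^sup>2 / 4"
      by (simp add: power2_norm_eq_inner inner_simps inner_commute)
    ultimately have "(norm (z - (1/2) *\<^sub>R S z))\<^sup>2 \<le> (norm z)\<^sup>2 - q / 2" by linarith
    moreover have "d * (norm z)\<^sup>2 \<le> q" unfolding q_def by (rule coercive[OF that])
    ultimately show ?thesis by (simp add: left_diff_distrib)
  qed
  have "\<exists>!z\<in>K. f z = z"
  proof (rule Banach_fix)
    show "complete K" using K(1) by (simp add: complete_eq_closed)
    show "K \<noteq> {}" using subspace_0[OF K(2)] by blast
    show "0 \<le> sqrt (1 - d/2)" "sqrt (1 - d/2) < 1" using \<open>0 < d\<close> \<open>d \<le> 1\<close> by auto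
    show "f ` K \<subseteq> K"
    proof (intro image_subsetI)
      fix z assume "z \<in> K"
      have "S z - (a + b) \<in> K"
        using ab in_U K unfolding S_def by (intro subspace_diff subspace_add) auto
      with \<open>z \<in> K\<close> show "f z \<in> K"
        unfolding f_def by (rule subspace_diff[OF K(2) _ subspace_scale[OF K(2)]])
    qed
    fix x y assume "x \<in> K" "y \<in> K"
    have "f x - f y = (x - y) - (1/2) *\<^sub>R S (x - y)"
      by (simp add: f_def Sdiff scaleR_diff_right)
    then have "(dist (f x) (f y))\<^sup>2 \<le> (1 - d/2) * (dist x y)\<^sup>2"
      using shrink[of "x - y"] K \<open>x \<in> K\<close> \<open>y \<in> K\<close> by (simp add: dist_norm subspace_diff)
    also have "\<dots> = (sqrt (1 - d/2) * dist x y)\<^sup>2"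
      using \<open>d \<le> 1\<close> by (simp add: power_mult_distrib)
    finally show "dist (f x) (f y) \<le> sqrt (1 - d/2) * dist x y"
      by (rule power2_le_imp_le) (use \<open>d \<le> 1\<close> in auto)
  qed
  then obtain z where "f z = z" by blast
  then have "S z = a + b" by (simp add: f_def)
  then have "projector U1 z - a = b - projector U2 z" by (simp add: S_def algebra_simps)
  moreover have "projector U1 z - a \<in> U1" "b - projector U2 z \<in> U2"
    using ab in_U U1 U2 by (auto simp: subspace_diff)
  ultimately have "projector U1 z - a \<in> U1 \<inter> U2" "b - projector U2 z \<in> U1 \<inter> U2" by auto
  then show "\<exists>z. projector U1 z = a \<and> projector U2 z = b" unfolding int by auto
qed

lemma linear_alternating_step: "linear (alternating_step U1 U2)"
proof -
  interpret P1: linear "projector U1" by (rule linear_projector[OF U1])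
  interpret P2: linear "projector U2" by (rule linear_projector[OF U2])
  show ?thesis
    by (rule linearI)
      (simp_all add: alternating_step_def Let_def P1.add P2.add P1.diff P2.diff P1.scale P2.scale
        algebra_simps)
qed

lemma norm_alternating_step_le: "norm (alternating_step U1 U2 x) \<le> norm x"
  unfolding alternating_step_def Let_def
  using norm_projector_complement_le[OF U1] norm_projector_complement_le[OF U2]
  by (rule order_trans)

lemma norm_displacement_le:
  "norm (z - alternating_step U1 U2 z) \<le> norm (projector U1 z) + norm (projector U2 z)"
proof -
  interpret P1: linear "projector U1" by (rule linear_projector[OF U1])
  have "z - alternating_step U1 U2 z
      = projector U1 z + (projector U2 z - projector U1 (projector U2 z))"
    by (simp add: alternating_step_def Let_def P1.diff)
  also have "norm \<dots> \<le> norm (projector U1 z) + norm (projector U2 z - projector U1 (projector U2 z))"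
    by (rule norm_triangle_ineq)
  also have "\<dots> \<le> norm (projector U1 z) + norm (projector U2 z)"
    using norm_projector_complement_le[OF U1] by simp
  finally show ?thesis .
qed

lemma norm_funpow_displacement_le:
  "norm (z - (alternating_step U1 U2 ^^ n) z) \<le> real n * norm (z - alternating_step U1 U2 z)"
proof (induction n)
  case (Suc n)
  let ?T = "alternating_step U1 U2"
  interpret Tn: linear "?T ^^ n" by (rule linear_funpow[OF linear_alternating_step])
  have "z - (?T ^^ Suc n) z = (z - (?T ^^ n) z) + (?T ^^ n) (z - ?T z)"
    by (simp add: Tn.diff funpow_swap1)
  also have "norm \<dots> \<le> norm (z - (?T ^^ n) z) + norm ((?T ^^ n) (z - ?T z))"
    by (rule norm_triangle_ineq)
  also have "norm ((?T ^^ n) (z - ?T z)) \<le> norm (z - ?T z)"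
    using norm_funpow_antimono[of ?T 0 n] norm_alternating_step_le by simp
  finally show ?case using Suc by (simp add: algebra_simps)
qed simp

text \<open>
  A unit vector whose two projections have norm at most \<open>1 / (8 (n + 1))\<close> moves by at most
  \<open>1 / 4\<close> in \<open>n\<close> steps. Without such a vector in \<open>K\<close> the form of \<open>coercive_imp_ibap\<close> would be coercive.
\<close>

lemma not_ibap_imp_powers_almost_isometric:
  assumes "U1 \<inter> U2 = {0}" "\<not> ibap U1 U2"
  shows "\<exists>z\<in>K. norm z = 1 \<and> 3/4 \<le> norm ((alternating_step U1 U2 ^^ n) z)"
proof -
  let ?T = "alternating_step U1 U2"
  interpret P1: linear "projector U1" by (rule linear_projector[OF U1])
  interpret P2: linear "projector U2" by (rule linear_projector[OF U2])
  define e where "e = 1 / (8 * real (Suc n))"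
  have e: "0 < e" "e\<^sup>2 \<le> 1" "8 * real n * e \<le> 1"
    by (auto simp: e_def field_simps intro!: power_le_one)
  have "\<exists>x\<in>K. (norm (projector U1 x))\<^sup>2 + (norm (projector U2 x))\<^sup>2 < e\<^sup>2 * (norm x)\<^sup>2"
    using coercive_imp_ibap[OF assms(1), of "e\<^sup>2"] assms(2) e by (force simp: not_le[symmetric])
  then obtain x where x: "x \<in> K"
    "(norm (projector U1 x))\<^sup>2 + (norm (projector U2 x))\<^sup>2 < (e * norm x)\<^sup>2"
    by (auto simp: power_mult_distrib)
  then have "x \<noteq> 0" by auto
  have "(norm (projector U1 x))\<^sup>2 \<le> (e * norm x)\<^sup>2" "(norm (projector U2 x))\<^sup>2 \<le> (e * norm x)\<^sup>2"
    using x(2) zero_le_power2[of "norm (projector U1 x)"] zero_le_power2[of "norm (projector U2 x)"]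
    by linarith+
  from this[THEN power2_le_imp_le]
  have le: "norm (projector U1 x) \<le> e * norm x" "norm (projector U2 x) \<le> e * norm x"
    using e by simp_all
  define z where "z = (1 / norm x) *\<^sub>R x"
  have z: "z \<in> K" "norm z = 1" using x(1) \<open>x \<noteq> 0\<close> K by (auto simp: z_def subspace_scale)
  have "norm (projector U1 z) \<le> e" "norm (projector U2 z) \<le> e"
    using le \<open>x \<noteq> 0\<close> by (auto simp: z_def P1.scale P2.scale field_simps)
  then have "norm (z - ?T z) \<le> 2 * e" using norm_displacement_le[of z] by linarith
  then have "real n * norm (z - ?T z) \<le> real n * (2 * e)" by (rule mult_left_mono) simp
  then have "norm (z - (?T ^^ n) z) \<le> 1/4"
    using norm_funpow_displacement_le[of z n] e(3) by linarith
  then have "3/4 \<le> norm ((?T ^^ n) z)"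
    using norm_triangle_ineq2[of z "(?T ^^ n) z"] z(2) by linarith
  then show ?thesis using z by blast
qed

end


section \<open>Slow convergence of the affine iteration\<close>

theorem slow_alternating_projections:
  fixes U1 U2 :: "'a::{real_inner,complete_space} set" and \<alpha> :: "nat \<Rightarrow> real"
  assumes U1: "subspace U1" "closed U1" and U2: "subspace U2" "closed U2"
    and "U1 \<inter> U2 = {0}" "\<not> ibap U1 U2"
    and u: "u1 \<in> U1" "u2 \<in> U2" and "interp_set U1 U2 u1 u2 \<noteq> {}"
    and "\<And>n. \<alpha> n \<le> 1" "\<alpha> \<longlonglongrightarrow> 0"
  shows "\<exists>r x. x 0 = r \<and>
        (\<forall>n. x (Suc n) = projector ((+) u1 ` orthogonal_comp U1)
                          (projector ((+) u2 ` orthogonal_comp U2) (x n))) \<and>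
        (\<forall>n. norm (x n - projector (interp_set U1 U2 u1 u2) r) \<ge> \<alpha> n)"
proof -
  interpret P1: linear "projector U1" by (rule linear_projector[OF U1(2,1)])
  interpret P2: linear "projector U2" by (rule linear_projector[OF U2(2,1)])
  let ?T = "alternating_step U1 U2"
  define K where "K = orthogonal_comp (orthogonal_comp U1 \<inter> orthogonal_comp U2)"
  have K: "closed K" "subspace K" "U1 \<subseteq> K" "U2 \<subseteq> K"
    by (auto simp: K_def closed_orthogonal_comp subspace_orthogonal_comp)
      (auto simp: orthogonal_comp_def orthogonal_def inner_commute)
  note data = U1(2,1) U2(2,1) K
  obtain y where y: "y \<in> K" "\<And>n. \<alpha> n \<le> norm ((?T ^^ n) y)"
    using slow_orbit_exists[of ?T K \<alpha>] linear_alternating_step[OF data]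
      norm_alternating_step_le[OF data] not_ibap_imp_powers_almost_isometric[OF data] K assms
    by blast
  obtain s where s: "projector U1 s = u1" "projector U2 s = u2"
    using assms by (auto simp: interp_set_def)
  have best: "projector (interp_set U1 U2 u1 u2) (s + y) = s"
  proof (rule projector_eqI)
    show "s \<in> interp_set U1 U2 u1 u2" using s by (simp add: interp_set_def)
    fix t assume "t \<in> interp_set U1 U2 u1 u2"
    then have "t - s = (t - s) - projector U1 (t - s)" "t - s = (t - s) - projector U2 (t - s)"
      using s by (auto simp: interp_set_def P1.diff P2.diff)
    then have "t - s \<in> orthogonal_comp U1 \<inter> orthogonal_comp U2"
      using projector_subspace(2)[OF U1(2,1), of "t - s"]
        projector_subspace(2)[OF U2(2,1), of "t - s"] by auto
    then have "inner (t - s) y = 0" using y(1) unfolding K_def by (rule inner_orthogonal_comp)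
    then show "inner (s + y - s) (t - s) \<le> 0" by (simp add: inner_commute)
  qed
  define x where "x n = s + (?T ^^ n) y" for n
  have "x (Suc n) = projector ((+) u1 ` orthogonal_comp U1)
                     (projector ((+) u2 ` orthogonal_comp U2) (x n))" for n
    using s
    by (simp add: x_def projector_affine[OF U1(2,1) u(1)] projector_affine[OF U2(2,1) u(2)]
        alternating_step_def Let_def P1.add P2.add P1.diff)
  moreover have "\<alpha> n \<le> norm (x n - projector (interp_set U1 U2 u1 u2) (s + y))" for n
    unfolding best using y(2) by (simp add: x_def)
  moreover have "x 0 = s + y" by (simp add: x_def)
  ultimately show ?thesis by blast
qed

theorem proposition3p3:
  fixes U1 U2 :: "'a::{real_inner,complete_space} set" and u1 u2 :: 'a
    and V1 V2 :: "'b::{complex_inner,complete_space} set" and v1 v2 :: 'b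
    and \<alpha> :: "nat \<Rightarrow> real"
  assumes "\<And>n. 0 < \<alpha> n \<and> \<alpha> n < 1" and "decseq \<alpha>" and "\<alpha> \<longlonglongrightarrow> 0"
  shows
    "(subspace U1 \<and> closed U1 \<and> subspace U2 \<and> closed U2 \<and> U1 \<inter> U2 = {0} \<and> \<not> ibap U1 U2 \<and>
        u1 \<in> U1 \<and> u2 \<in> U2 \<and> interp_set U1 U2 u1 u2 \<noteq> {} \<longrightarrow>
      (\<exists>r x. x 0 = r \<and>
        (\<forall>n. x (Suc n) = projector ((+) u1 ` orthogonal_comp U1)
                          (projector ((+) u2 ` orthogonal_comp U2) (x n))) \<and>
        (\<forall>n. norm (x n - projector (interp_set U1 U2 u1 u2) r) \<ge> \<alpha> n))) \<and>
     (csubspace V1 \<and> closed V1 \<and> csubspace V2 \<and> closed V2 \<and> V1 \<inter> V2 = {0} \<and> \<not> ibap V1 V2 \<and>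
        v1 \<in> V1 \<and> v2 \<in> V2 \<and> interp_set V1 V2 v1 v2 \<noteq> {} \<longrightarrow>
      (\<exists>r x. x 0 = r \<and>
        (\<forall>n. x (Suc n) = projector ((+) v1 ` corthogonal_comp V1)
                          (projector ((+) v2 ` corthogonal_comp V2) (x n))) \<and>
        (\<forall>n. norm (x n - projector (interp_set V1 V2 v1 v2) r) \<ge> \<alpha> n)))"
proof -
  have \<alpha>: "\<alpha> n \<le> 1" for n using assms(1)[of n] by simp
  show ?thesis
    using slow_alternating_projections[of U1 U2 u1 u2 \<alpha>, OF _ _ _ _ _ _ _ _ _ \<alpha> assms(3)]
      slow_alternating_projections[of V1 V2 v1 v2 \<alpha>, OF _ _ _ _ _ _ _ _ _ \<alpha> assms(3)]
    by (intro conjI impI) (simp_all add: csubspace_imp_subspace corthogonal_comp_eq)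
qed

end
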